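(* Let $P_0=P_0(G,H,\Gamma,W_0)$ be a regular model set in a lcsc group $G$, let $X^\times=X^\times_{P_0}$ be its punctured hull, let $Y:=(G\times H)/\Gamma$, and let $y_0:=(e,e)\Gamma\in Y$. There exists a unique $G$-equivariant Borel map $\beta:X^\times\to Y$ which maps $P_0$ to $y_0$ and has a closed graph. This map has the following additional properties: (i) If $Y^{\rm ns}:=\{(g,h)\Gamma\in Y : h^{-1}W_0\text{ is }\Gamma\text{-regular}\}$ and $X^{\rm ns}:=\beta^{-1}(Y^{\rm ns})$, then $\beta|_{X^{\rm ns}}:X^{\rm ns}\to Y^{\rm ns}$ is bijective. (ii) For $P\in X^\times$: $P\in\mathcal T$ if and only if there exists $h_P\in H$ such that $\beta(P)=(e,h_P)\Gamma$. (iii) If $P\in\mathcal T\cap X^{\rm ns}$ and $h_P$ is as in (ii), then $P=\tau^{-1}(h_P^{-1}W_0)$. (iv) If $\Gamma$ is cocompact in $G\times H$, then $\beta$ is continuous.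
   Context: lcsc means locally compact second countable. A lattice in a lcsc group $L$ is a discrete subgroup $\Gamma<L$ such that $L/\Gamma$ admits an $L$-invariant probability measure. A cut-and-project scheme is a triple $(G,H,\Gamma)$ with $G,H$ lcsc groups and $\Gamma<G\times H$ a lattice such that the coordinate projection $\pi_G$ is injective on $\Gamma$ and $\pi_H(\Gamma)$ is dense in $H$. Put $\Gamma_G=\pi_G(\Gamma)$ and $\tau := \pi_H\circ(\pi_G|_\Gamma)^{-1}:\Gamma_G\to H$. A compact set $W\subset H$ is $\Gamma$-regular if $\partial W\cap\pi_H(\Gamma)=\emptyset$. A regular model set in $G$ is a set $P_0=P_0(G,H,\Gamma,W_0):=\tau^{-1}(W_0)$, where $W_0\subset H$ is compact with non-empty interior, is Jordan-measurable ($m_H(\partial W_0)=0$ for Haar measure $m_H$), has dense interior ($W_0$ is the closure of its interior), has trivial stabilizer $\{h\in H : hW_0=W_0\}=\{e\}$, and is $\Gamma$-regular. The Chabauty--Fell topology on the set $\mathcal C(G)$ of closed subsets of $G$ is generated by the sets $\{C : C\cap V\neq\emptyset\}$ ($V$ open) and $\{C : C\cap K=\emptyset\}$ ($K$ compact). $G$ acts on $\mathcal C(G)$ by left translation; $X_{P_0}$ is the closure of $G.P_0$, and $X_{P_0}^\times := X_{P_0}\setminus\{\emptyset\}$. $G$ acts on $Y$ by left multiplication in the first factor. The canonical transversal is $\mathcal T:=\{P\in X^\times_{P_0} : P\subset\Gamma_G\}$. *)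

theory Defs
  imports "HOL-Analysis.Analysis" "HOL-Probability.Probability_Measure" "HOL-Library.Set_Algebras"
begin

section \<open>Locally compact second countable groups\<close>

text \<open>
  The library class for not necessarily abelian topological groups is additive, so groups are
  written additively: a product \<open>x y\<close> is \<open>x + y\<close>, the unit \<open>e\<close> is \<open>0\<close>, the inverse
  of \<open>x\<close> is \<open>- x\<close>, and a left translate or left coset \<open>x S\<close> is \<open>x +o S\<close>.
  Commutativity is never assumed.
\<close>

class lcsc_group_add = topological_group_add + t2_space + second_countable_topology +
  assumes ex_compact_neighbourhood: "\<exists>U K. open U \<and> compact K \<and> x \<in> U \<and> U \<subseteq> K"

lemma locally_compact_euclidean: "locally_compact_space (euclidean :: 'a::lcsc_group_add topology)"
  using ex_compact_neighbourhood by (auto simp: locally_compact_space_def)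

instance prod :: (topological_group_add, topological_group_add) topological_group_add
proof
  fix a b :: "'a \<times> 'b"
  have "((\<lambda>x. fst x + snd x) \<longlongrightarrow> a + b) (nhds (a, b))"
    unfolding plus_prod_def
    by (intro tendsto_Pair tendsto_add tendsto_fst tendsto_snd filterlim_ident)
       (auto intro!: tendsto_eq_intros filterlim_ident)
  then show "((\<lambda>x. fst x + snd x) \<longlongrightarrow> a + b) (nhds a \<times>\<^sub>F nhds b)"
    by (simp add: nhds_prod)
  show "(uminus \<longlongrightarrow> - a) (nhds a)"
    unfolding uminus_prod_def
    by (intro tendsto_Pair tendsto_minus tendsto_fst tendsto_snd filterlim_ident)
qed

instance prod :: (lcsc_group_add, lcsc_group_add) lcsc_group_add
proof
  have "locally_compact_space (prod_topology (euclidean :: 'a topology) (euclidean :: 'b topology))"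
    by (intro iffD2[OF locally_compact_space_prod_topology] disjI2 conjI locally_compact_euclidean)
  then show "\<exists>U K. open U \<and> compact K \<and> x \<in> U \<and> U \<subseteq> K" for x :: "'a \<times> 'b"
    by (cases x) (simp add: locally_compact_space_def)
qed

definition add_subgroup :: "'a::group_add set \<Rightarrow> bool" where
  "add_subgroup S \<longleftrightarrow> 0 \<in> S \<and> (\<forall>x\<in>S. \<forall>y\<in>S. x + y \<in> S) \<and> (\<forall>x\<in>S. - x \<in> S)"

section \<open>Borel structures, coset spaces, lattices\<close>

definition borel_of :: "'a topology \<Rightarrow> 'a measure" where
  "borel_of X = sigma (topspace X) {U. openin X U}"

definition coset_space :: "'a::group_add set \<Rightarrow> 'a set set" where
  "coset_space \<Gamma> = range (\<lambda>x. x +o \<Gamma>)"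

definition coset_topology :: "'a::{group_add, topological_space} set \<Rightarrow> 'a set topology" where
  "coset_topology \<Gamma> = topology (\<lambda>U. U \<subseteq> coset_space \<Gamma> \<and> open ((\<lambda>x. x +o \<Gamma>) -` U))"

lemma openin_coset_topology:
  "openin (coset_topology \<Gamma>) U \<longleftrightarrow> U \<subseteq> coset_space \<Gamma> \<and> open ((\<lambda>x. x +o \<Gamma>) -` U)"
proof -
  have "istopology (\<lambda>U. U \<subseteq> coset_space \<Gamma> \<and> open ((\<lambda>x. x +o \<Gamma>) -` U))"
    by (auto simp: istopology_def vimage_Union)
  then show ?thesis
    by (simp add: coset_topology_def topology_inverse')
qed

lemma topspace_coset_topology [simp]: "topspace (coset_topology \<Gamma>) = coset_space \<Gamma>"
proof -
  have "openin (coset_topology \<Gamma>) (coset_space \<Gamma>)"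
    by (auto simp: openin_coset_topology coset_space_def vimage_def)
  then show ?thesis
    by (meson openin_coset_topology openin_subset openin_topspace subset_antisym)
qed

lemma quotient_map_coset_topology: "quotient_map euclidean (coset_topology \<Gamma>) (\<lambda>x. x +o \<Gamma>)"
  by (auto simp: quotient_map_def openin_coset_topology vimage_def) (auto simp: coset_space_def)

definition is_lattice :: "'a::lcsc_group_add set \<Rightarrow> bool" where
  "is_lattice \<Gamma> \<longleftrightarrow> add_subgroup \<Gamma> \<and> discrete \<Gamma> \<and>
     (\<exists>M. sets M = sets (borel_of (coset_topology \<Gamma>)) \<and> prob_space M \<and>
          (\<forall>x. distr M M (\<lambda>y. x +o y) = M))"

text \<open>
  On a locally compact second countable group every Borel measure that is finite on compact sets
  is regular, so no regularity clause is needed.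
\<close>

definition haar_measure :: "'a::lcsc_group_add measure \<Rightarrow> bool" where
  "haar_measure m \<longleftrightarrow> sets m = sets borel \<and> emeasure m UNIV \<noteq> 0 \<and>
     (\<forall>K. compact K \<longrightarrow> emeasure m K < \<infinity>) \<and>
     (\<forall>x. distr m m (\<lambda>y. x + y) = m)"

section \<open>Regular model sets\<close>

definition cut_and_project_scheme :: "('g::lcsc_group_add \<times> 'h::lcsc_group_add) set \<Rightarrow> bool" where
  "cut_and_project_scheme \<Gamma> \<longleftrightarrow> is_lattice \<Gamma> \<and> inj_on fst \<Gamma> \<and> closure (snd ` \<Gamma>) = UNIV"

text \<open>\<open>star_map \<Gamma>\<close> is the map \<open>\<tau>\<close>; only its values on \<open>fst ` \<Gamma>\<close> are meaningful.\<close>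

definition star_map :: "('g \<times> 'h) set \<Rightarrow> 'g \<Rightarrow> 'h" where
  "star_map \<Gamma> = snd \<circ> the_inv_into \<Gamma> fst"

definition model_set :: "('g \<times> 'h) set \<Rightarrow> 'h set \<Rightarrow> 'g set" where
  "model_set \<Gamma> W = {x \<in> fst ` \<Gamma>. star_map \<Gamma> x \<in> W}"

definition gamma_regular :: "('g \<times> 'h::topological_space) set \<Rightarrow> 'h set \<Rightarrow> bool" where
  "gamma_regular \<Gamma> W \<longleftrightarrow> compact W \<and> frontier W \<inter> snd ` \<Gamma> = {}"

definition regular_window ::
    "('g::lcsc_group_add \<times> 'h::lcsc_group_add) set \<Rightarrow> 'h measure \<Rightarrow> 'h set \<Rightarrow> bool" where
  "regular_window \<Gamma> m W \<longleftrightarrow>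
     compact W \<and> interior W \<noteq> {} \<and> emeasure m (frontier W) = 0 \<and> W = closure (interior W) \<and>
     {h. h +o W = W} = {0} \<and> gamma_regular \<Gamma> W"

section \<open>Hull and transversal\<close>

text \<open>The generator obtained from \<open>K = {}\<close> makes the underlying set all closed subsets.\<close>

definition chabauty_fell :: "'a::topological_space set topology" where
  "chabauty_fell = topology_generated_by
     ({{C. closed C \<and> C \<inter> V \<noteq> {}} | V. open V} \<union> {{C. closed C \<and> C \<inter> K = {}} | K. compact K})"

lemma topspace_chabauty_fell: "topspace chabauty_fell = {C. closed C}"
proof -
  have "{C. closed C} \<in> {{C. closed C \<and> C \<inter> K = {}} | K. compact K}"
    by (rule CollectI, rule exI[of _ "{}"]) simp
  then show ?thesis
    unfolding chabauty_fell_def topology_generated_by_topspace by blast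
qed

definition translation_hull :: "'g::{group_add, topological_space} set \<Rightarrow> 'g set set" where
  "translation_hull P\<^sub>0 = chabauty_fell closure_of (range (\<lambda>g. g +o P\<^sub>0))"

definition punctured_hull :: "'g::{group_add, topological_space} set \<Rightarrow> 'g set set" where
  "punctured_hull P\<^sub>0 = translation_hull P\<^sub>0 - {{}}"

definition punctured_hull_topology ::
    "'g::{group_add, topological_space} set \<Rightarrow> 'g set topology" where
  "punctured_hull_topology P\<^sub>0 = subtopology chabauty_fell (punctured_hull P\<^sub>0)"

definition canonical_transversal ::
    "('g::{group_add, topological_space} \<times> 'h) set \<Rightarrow> 'g set \<Rightarrow> 'g set set" where
  "canonical_transversal \<Gamma> P\<^sub>0 = {P \<in> punctured_hull P\<^sub>0. P \<subseteq> fst ` \<Gamma>}"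

text \<open>
  Maps out of the punctured hull are extensional functions (\<open>\<rightarrow>\<^sub>E\<close>), so that equality in
  \<open>'g set \<Rightarrow> ('g \<times> 'h) set\<close> is equality of maps on the punctured hull.
\<close>

definition parametrization_map ::
    "('g::lcsc_group_add \<times> 'h::lcsc_group_add) set \<Rightarrow> 'g set
      \<Rightarrow> ('g set \<Rightarrow> ('g \<times> 'h) set) \<Rightarrow> bool" where
  "parametrization_map \<Gamma> P\<^sub>0 \<beta> \<longleftrightarrow>
     \<beta> \<in> punctured_hull P\<^sub>0 \<rightarrow>\<^sub>E coset_space \<Gamma> \<and>
     (\<forall>g. \<forall>P\<in>punctured_hull P\<^sub>0. \<beta> (g +o P) = (g, 0) +o \<beta> P) \<and>
     \<beta> \<in> borel_of (punctured_hull_topology P\<^sub>0) \<rightarrow>\<^sub>M borel_of (coset_topology \<Gamma>) \<and>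
     \<beta> P\<^sub>0 = (0, 0) +o \<Gamma> \<and>
     closedin (prod_topology (punctured_hull_topology P\<^sub>0) (coset_topology \<Gamma>))
       {(P, \<beta> P) | P. P \<in> punctured_hull P\<^sub>0}"

definition nonsingular_cosets ::
    "('g::lcsc_group_add \<times> 'h::lcsc_group_add) set \<Rightarrow> 'h set \<Rightarrow> ('g \<times> 'h) set set" where
  "nonsingular_cosets \<Gamma> W = {(g, h) +o \<Gamma> | g h. gamma_regular \<Gamma> ((- h) +o W)}"

end

theory Submission
  imports Defs
begin

text \<open>
  A coset \<open>y\<close> of \<open>\<Gamma>\<close> is itself a subset of \<open>G \<times> H\<close>, and cutting it with the strip \<open>G \<times> A\<close> and
  projecting to \<open>G\<close> gives a set \<open>cut_points A y\<close>. In particular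
  \<open>P\<^sub>0 = cut_points W\<^sub>0 \<Gamma>\<close>, and \<open>g +o P\<^sub>0\<close> is obtained from the coset of
  \<open>(g, 0)\<close>. Say that \<open>y\<close> fits \<open>P\<close> if \<open>cut_points (interior W\<^sub>0) y \<subseteq> P \<subseteq> cut_points W\<^sub>0 y\<close>. The map \<open>\<beta>\<close> sends each \<open>P\<close> in the
  punctured hull to the one coset that fits it, so its graph is the relation of fitting.

  This relation is closed (\<open>closedin_fits\<close>): each of the two inclusions, where it fails, fails on a
  neighbourhood, because meeting an open set and missing a compact set are open conditions
  both on closed sets and on cosets, and \<open>W\<^sub>0\<close> is compact. A set is fitted by at most one
  coset (\<open>fitting_coset_unique\<close>): through a common point \<open>x\<close>, two fitting cosets are those of
  \<open>(x, w)\<close> and \<open>(x, v)\<close>; the density of the projection of \<open>\<Gamma>\<close> to \<open>H\<close> forces the two translates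
  of the window to coincide, and the window has trivial stabilizer.

  The decisive compactness argument is local: if \<open>P\<close> meets a compact set \<open>K\<close>, then every coset that
  fits \<open>P\<close> lies in the image of \<open>K \<times> W\<^sub>0\<close>, which is compact. The sets \<open>P\<close> meeting the interior of
  such a \<open>K\<close> form an open cover of the punctured hull. On each piece of it the relation of
  fitting is closed and takes values in a compact set. Since it contains the orbit of \<open>P\<^sub>0\<close>, it
  is defined on the whole hull (\<open>fitting_coset_exists\<close>), and it is a continuous map
  (\<open>continuous_map_fitting_coset\<close>). In particular \<open>\<beta>\<close> is Borel. A competing map with a closed
  graph agrees with \<open>\<beta>\<close> on the orbit by equivariance, hence on its closure.

  Over a nonsingular coset \<open>y\<close> both bounds in the definition of fitting agree, so \<open>P\<close> can be
  recovered as \<open>cut_points W\<^sub>0 y\<close>. Moreover \<open>y \<mapsto> cut_points W\<^sub>0 y\<close> is continuous on such cosets, and the orbit of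
  the trivial coset \<open>\<Gamma>\<close> is dense among them, so that \<open>cut_points W\<^sub>0 y\<close> does lie in the hull.
\<close>

section \<open>Closed relations and compact sets\<close>

text \<open>
  This form of compactness replaces all arguments by convergent subsequences: a limit of points
  related to elements of a compact set is itself related to one of them.
\<close>

lemma closedin_projection_along_compact:
  assumes "closedin (prod_topology X Y) S" "compactin Y K"
  shows "closedin X {x \<in> topspace X. \<exists>k\<in>K. (x, k) \<in> S}"
proof -
  have K: "K \<subseteq> topspace Y"
    using assms(2) compactin_subset_topspace by blast
  have "prod_topology X (subtopology Y K) = subtopology (prod_topology X Y) (topspace X \<times> K)"
    using subtopology_Times[of X Y "topspace X" K] by simp
  moreover have "closedin (subtopology (prod_topology X Y) (topspace X \<times> K)) (S \<inter> topspace X \<times> K)"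
    using assms(1) by (auto simp: closedin_subtopology)
  moreover have "closed_map (prod_topology X (subtopology Y K)) X fst"
    by (intro Abstract_Topological_Spaces.closed_map_fst compact_space_subtopology assms)
  ultimately have "closedin X (fst ` (S \<inter> topspace X \<times> K))"
    by (simp add: closed_map_def)
  moreover have "fst ` (S \<inter> topspace X \<times> K) = {x \<in> topspace X. \<exists>k\<in>K. (x, k) \<in> S}"
    by force
  ultimately show ?thesis by simp
qed

text \<open>
  A local version of the closed graph theorem for maps into a compact space. If \<open>f\<close> sends \<open>N\<close> into the
  compact set \<open>Q\<close>, then the points of \<open>N\<close> not sent into the open set \<open>V\<close> are those which the graph
  relates to the compact set \<open>Q - V\<close>, and they form a relatively closed set.
\<close>

lemma continuous_map_if_closed_graph_locally_compact_range:
  assumes f: "f \<in> topspace X \<rightarrow> topspace Y"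
    and graph: "closedin (prod_topology X Y) {(x, f x) | x. x \<in> topspace X}"
    and loc: "\<And>x. x \<in> topspace X \<Longrightarrow>
      \<exists>N Q. openin X N \<and> x \<in> N \<and> compactin Y Q \<and> f ` N \<subseteq> Q"
  shows "continuous_map X Y f"
proof -
  have "openin X {x \<in> topspace X. f x \<in> V}" if V: "openin Y V" for V
  proof (subst openin_subopen, rule ballI)
    fix x assume x: "x \<in> {x \<in> topspace X. f x \<in> V}"
    then obtain N Q where N: "openin X N" "x \<in> N" and Q: "compactin Y Q" and fN: "f ` N \<subseteq> Q"
      using loc by blast
    have "compactin Y ((topspace Y - V) \<inter> Q)"
      using V Q by (intro closed_Int_compactin) auto
    then have B: "closedin X {x \<in> topspace X.
        \<exists>q\<in>(topspace Y - V) \<inter> Q. (x, q) \<in> {(x, f x) | x. x \<in> topspace X}}" (is "closedin X ?B")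
      by (rule closedin_projection_along_compact[OF graph])
    have "N \<subseteq> topspace X" using N(1) openin_subset by blast
    then have "openin X (N - ?B) \<and> x \<in> N - ?B \<and> N - ?B \<subseteq> {x \<in> topspace X. f x \<in> V}"
      using N B x fN f by (auto simp: openin_diff)
    then show "\<exists>T. openin X T \<and> x \<in> T \<and> T \<subseteq> {x \<in> topspace X. f x \<in> V}" by blast
  qed
  then show ?thesis using f by (simp add: continuous_map_def Pi_iff)
qed

lemma compact_neighbourhood_inside_open:
  fixes x :: "'a::lcsc_group_add"
  assumes "open V" "x \<in> V"
  obtains U K where "open U" "compact K" "x \<in> U" "U \<subseteq> K" "K \<subseteq> V"
proof -
  have "Hausdorff_space (euclidean :: 'a topology)"
    unfolding Hausdorff_space_def disjnt_def using hausdorff by auto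
  then have "neighbourhood_base_of (compactin euclidean) (euclidean :: 'a topology)"
    using locally_compact_space_neighbourhood_base locally_compact_euclidean by blast
  then obtain U K where "open U" "compact K" "x \<in> U" "U \<subseteq> K" "K \<subseteq> V"
    using assms unfolding neighbourhood_base_of by (metis compactin_euclidean_iff open_openin)
  then show ?thesis using that by blast
qed

section \<open>Cosets of closed subgroups\<close>

lemma mem_left_translate: "x \<in> a +o S \<longleftrightarrow> - a + x \<in> S" for a :: "'a::group_add"
  unfolding elt_set_plus_def by (auto simp: add.assoc[symmetric]) (metis add_minus_cancel)

lemma left_translate_left_translate: "a +o (b +o S) = (a + b) +o S" for a :: "'a::group_add"
  by (simp add: set_eq_iff mem_left_translate minus_add add.assoc del: add_uminus_conv_diff)

lemma left_translate_0: "0 +o S = S" for S :: "'a::group_add set"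
  by (auto simp: mem_left_translate)

lemma coset_eq_if_mem:
  assumes "add_subgroup S" "z \<in> a +o S"
  shows "a +o S = z +o S"
proof -
  have az: "- a + z \<in> S" using assms(2) by (simp add: mem_left_translate)
  then have za: "- z + a \<in> S"
    using assms(1) unfolding add_subgroup_def by (metis minus_add minus_minus)
  have "- a + x \<in> S \<longleftrightarrow> - z + x \<in> S" for x
  proof -
    have "- a + x = (- a + z) + (- z + x)" "- z + x = (- z + a) + (- a + x)"
      by (simp_all add: add.assoc)
    then show ?thesis using assms(1) az za unfolding add_subgroup_def by metis
  qed
  then show ?thesis by (auto simp: mem_left_translate)
qed

lemma coset_eq_if_mem_coset_space:
  "add_subgroup S \<Longrightarrow> y \<in> coset_space S \<Longrightarrow> z \<in> y \<Longrightarrow> y = z +o S"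
  unfolding coset_space_def using coset_eq_if_mem by blast

lemma left_translate_mem_coset_space: "y \<in> coset_space S \<Longrightarrow> a +o y \<in> coset_space S"
  unfolding coset_space_def by (auto simp: left_translate_left_translate)

text \<open>
  A neighbourhood of \<open>(x, x)\<close> on which the difference stays in an open set \<open>U\<close> with \<open>U \<inter> S = {0}\<close>
  contains no two distinct points of \<open>S\<close>. Hence every \<open>x\<close> outside \<open>S\<close> has a neighbourhood with at
  most one point of \<open>S\<close>, and this point can be removed.
\<close>

lemma closed_discrete_subgroup:
  fixes S :: "'a::{topological_group_add, t2_space} set"
  assumes S: "add_subgroup S" and "discrete S"
  shows "closed S"
proof -
  have "0 \<in> S" using S by (simp add: add_subgroup_def)
  then have "0 isolated_in S" by (rule discreteD[OF assms(2)])
  then obtain U where U: "open U" "U \<inter> S = {0}" by (elim isolated_inE)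
  have "open ((\<lambda>p. - fst p + snd p) -` U :: ('a \<times> 'a) set)"
    by (intro open_vimage U continuous_intros)
  have "\<exists>T. open T \<and> x \<in> T \<and> T \<subseteq> - S" if x: "x \<in> - S" for x
  proof -
    have "(x, x) \<in> (\<lambda>p. - fst p + snd p) -` U" using U by auto
    then obtain A B where AB: "open A" "open B" "x \<in> A" "x \<in> B"
        "A \<times> B \<subseteq> (\<lambda>p. - fst p + snd p) -` U"
      using \<open>open ((\<lambda>p. - fst p + snd p) -` U)\<close> by (elim open_prod_elim) auto
    have eq: "a = b" if "a \<in> A \<inter> B \<inter> S" "b \<in> A \<inter> B \<inter> S" for a b
    proof -
      have "- a + b \<in> U \<inter> S" using that AB S unfolding add_subgroup_def by auto
      then have "- a + b = 0" using U by blast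
      then show ?thesis by (metis add.right_neutral add_minus_cancel)
    qed
    have "finite (A \<inter> B \<inter> S)"
    proof (cases "A \<inter> B \<inter> S = {}")
      case False
      then obtain a where "a \<in> A \<inter> B \<inter> S" by blast
      then have "A \<inter> B \<inter> S \<subseteq> {a}" using eq by blast
      then show ?thesis using finite_subset by blast
    qed simp
    then have "open (A \<inter> B - A \<inter> B \<inter> S)"
      by (intro open_Diff finite_imp_closed open_Int AB)
    then show ?thesis using AB x by (intro exI[of _ "A \<inter> B - A \<inter> B \<inter> S"]) auto
  qed
  then have "open (- S)" using open_subopen[of "- S"] by simp
  then show ?thesis by (simp add: closed_def)
qed

text \<open>
  Cosets, regarded as closed sets, satisfy the two types of open conditions that generate the
  Chabauty--Fell topology. This lets neighbourhoods of a point set and of a coset be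
  chosen in parallel.
\<close>

lemma openin_cosets_meeting_open:
  fixes S :: "'a::{topological_group_add, t2_space} set"
  assumes "open V"
  shows "openin (coset_topology S) {y \<in> coset_space S. y \<inter> V \<noteq> {}}"
proof -
  have "open ((\<lambda>x. x + s) -` V)" for s :: 'a
    by (intro open_vimage assms continuous_intros)
  moreover have "(\<lambda>x. x +o S) -` {y \<in> coset_space S. y \<inter> V \<noteq> {}} = (\<Union>s\<in>S. (\<lambda>x. x + s) -` V)"
    by (auto simp: coset_space_def elt_set_plus_def)
  ultimately show ?thesis by (auto simp: openin_coset_topology)
qed

lemma openin_cosets_missing_compact:
  fixes S :: "'a::{topological_group_add, t2_space} set"
  assumes "closed S" "compact K"
  shows "openin (coset_topology S) {y \<in> coset_space S. y \<inter> K = {}}"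
proof -
  have "closed ((\<lambda>p. - fst p + snd p) -` S :: ('a \<times> 'a) set)"
    by (intro closed_vimage assms continuous_intros)
  then have "closedin euclidean {x \<in> topspace euclidean. \<exists>k\<in>K. (x, k) \<in> (\<lambda>p. - fst p + snd p) -` S}"
    by (intro closedin_projection_along_compact[of _ euclidean])
      (use assms in \<open>simp_all add: euclidean_product_topology\<close>)
  then have "closed {x. \<exists>k\<in>K. - x + k \<in> S}" by simp
  moreover have "(\<lambda>x. x +o S) -` {y \<in> coset_space S. y \<inter> K = {}} = - {x. \<exists>k\<in>K. - x + k \<in> S}"
    by (auto simp: coset_space_def mem_left_translate)
  ultimately show ?thesis by (auto simp: openin_coset_topology)
qed

lemma closed_coset:
  fixes S :: "'a::{topological_group_add, t2_space} set"
  assumes "closed S" "y \<in> coset_space S"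
  shows "closed y"
proof -
  obtain a where "y = a +o S" using assms(2) unfolding coset_space_def by blast
  then have "y = (\<lambda>x. - a + x) -` S" by (auto simp: mem_left_translate)
  moreover have "closed ((\<lambda>x. - a + x) -` S)" by (intro closed_vimage assms continuous_intros)
  ultimately show ?thesis by simp
qed

section \<open>The Chabauty--Fell topology and hulls\<close>

lemma openin_chabauty_fell_meeting_open:
  "open V \<Longrightarrow> openin chabauty_fell {C. closed C \<and> C \<inter> V \<noteq> {}}"
  unfolding chabauty_fell_def by (rule topology_generated_by_Basis) blast

lemma openin_chabauty_fell_missing_compact:
  "compact K \<Longrightarrow> openin chabauty_fell {C. closed C \<and> C \<inter> K = {}}"
  unfolding chabauty_fell_def by (rule topology_generated_by_Basis) blast

lemma continuous_map_into_chabauty_fell: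
  assumes "\<And>x. x \<in> topspace X \<Longrightarrow> closed (f x)"
    and "\<And>V. open V \<Longrightarrow> openin X {x \<in> topspace X. f x \<inter> V \<noteq> {}}"
    and "\<And>K. compact K \<Longrightarrow> openin X {x \<in> topspace X. f x \<inter> K = {}}"
  shows "continuous_map X chabauty_fell f"
  unfolding chabauty_fell_def
proof (rule continuous_on_generated_topo)
  fix U assume "U \<in> {{C. closed C \<and> C \<inter> V \<noteq> {}} | V. open V} \<union>
      {{C. closed C \<and> C \<inter> K = {}} | K. compact (K :: 'b set)}"
  then consider V where "open V" "U = {C. closed C \<and> C \<inter> V \<noteq> {}}"
    | K where "compact K" "U = {C. closed C \<and> C \<inter> K = {}}" by blast
  then show "openin X (f -` U \<inter> topspace X)"
  proof cases
    case 1
    then have "f -` U \<inter> topspace X = {x \<in> topspace X. f x \<inter> V \<noteq> {}}" using assms(1) by auto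
    then show ?thesis using assms(2)[OF 1(1)] by simp
  next
    case 2
    then have "f -` U \<inter> topspace X = {x \<in> topspace X. f x \<inter> K = {}}" using assms(1) by auto
    then show ?thesis using assms(3)[OF 2(1)] by simp
  qed
next
  show "f ` topspace X \<subseteq> \<Union> ({{C. closed C \<and> C \<inter> V \<noteq> {}} | V. open V} \<union>
      {{C. closed C \<and> C \<inter> K = {}} | K. compact (K :: 'b set)})" (is "_ \<subseteq> \<Union> ?B")
  proof -
    have "{C. closed C \<and> C \<inter> {} = {}} \<in> ?B" by (intro UnI2) blast
    moreover have "f ` topspace X \<subseteq> {C. closed C \<and> C \<inter> {} = {}}" using assms(1) by auto
    ultimately show ?thesis by (rule order_trans[OF _ Union_upper, rotated])
  qed
qed

lemma continuous_map_left_translate_chabauty_fell: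
  fixes g :: "'g::{topological_group_add, t2_space}"
  shows "continuous_map chabauty_fell chabauty_fell (\<lambda>C. g +o C)"
proof (rule continuous_map_into_chabauty_fell)
  fix C :: "'g set" assume "C \<in> topspace chabauty_fell"
  then have "closed ((\<lambda>x. - g + x) -` C)"
    by (intro closed_vimage continuous_intros) (auto simp: topspace_chabauty_fell)
  moreover have "(\<lambda>x. - g + x) -` C = g +o C" by (auto simp: mem_left_translate)
  ultimately show "closed (g +o C)" by simp
next
  fix V :: "'g set" assume "open V"
  then have "open ((\<lambda>x. g + x) -` V)" by (intro open_vimage continuous_intros)
  then have "openin chabauty_fell {C. closed C \<and> C \<inter> ((\<lambda>x. g + x) -` V) \<noteq> {}}"
    by (rule openin_chabauty_fell_meeting_open)
  moreover have "{C. closed C \<and> C \<inter> ((\<lambda>x. g + x) -` V) \<noteq> {}}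
      = {C \<in> topspace chabauty_fell. (g +o C) \<inter> V \<noteq> {}}"
    by (auto simp: topspace_chabauty_fell elt_set_plus_def)
  ultimately show "openin chabauty_fell {C \<in> topspace chabauty_fell. (g +o C) \<inter> V \<noteq> {}}" by simp
next
  fix K :: "'g set" assume "compact K"
  then have "compact ((\<lambda>x. - g + x) ` K)" by (intro compact_continuous_image continuous_intros)
  then have "openin chabauty_fell {C. closed C \<and> C \<inter> (\<lambda>x. - g + x) ` K = {}}"
    by (rule openin_chabauty_fell_missing_compact)
  moreover have "{C. closed C \<and> C \<inter> (\<lambda>x. - g + x) ` K = {}}
      = {C \<in> topspace chabauty_fell. (g +o C) \<inter> K = {}}"
    by (auto simp: topspace_chabauty_fell mem_left_translate)
  ultimately show "openin chabauty_fell {C \<in> topspace chabauty_fell. (g +o C) \<inter> K = {}}" by simp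
qed

text \<open>
  Translation is continuous in the Chabauty--Fell topology and preserves the orbit, hence it
  preserves the closure of the orbit.
\<close>

lemma left_translate_mem_punctured_hull:
  fixes P\<^sub>0 :: "'g::{topological_group_add, t2_space} set"
  assumes "P \<in> punctured_hull P\<^sub>0"
  shows "g +o P \<in> punctured_hull P\<^sub>0"
proof -
  let ?O = "range (\<lambda>g. g +o P\<^sub>0)"
  have "(\<lambda>C. g +o C) ` (chabauty_fell closure_of ?O) \<subseteq> chabauty_fell closure_of ((\<lambda>C. g +o C) ` ?O)"
    by (rule continuous_map_image_closure_subset[OF continuous_map_left_translate_chabauty_fell])
  also have "\<dots> \<subseteq> chabauty_fell closure_of ?O"
    by (rule closure_of_mono) (auto simp: left_translate_left_translate)
  finally show ?thesis
    using assms unfolding punctured_hull_def translation_hull_def by (auto simp: elt_set_plus_def)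
qed

lemma closed_if_mem_punctured_hull: "P \<in> punctured_hull P\<^sub>0 \<Longrightarrow> closed P"
  using closure_of_subset_topspace[of chabauty_fell "range (\<lambda>g. g +o P\<^sub>0)"]
  unfolding punctured_hull_def translation_hull_def topspace_chabauty_fell by blast

lemma topspace_punctured_hull_topology:
  "topspace (punctured_hull_topology P\<^sub>0) = punctured_hull P\<^sub>0"
  using closed_if_mem_punctured_hull
  by (auto simp: punctured_hull_topology_def topspace_chabauty_fell)

lemma mem_punctured_hull_self:
  fixes P\<^sub>0 :: "'g::{topological_group_add, t2_space} set"
  assumes "closed P\<^sub>0" "P\<^sub>0 \<noteq> {}"
  shows "P\<^sub>0 \<in> punctured_hull P\<^sub>0"
proof -
  have "P\<^sub>0 = 0 +o P\<^sub>0" by (simp add: left_translate_0)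
  then have "P\<^sub>0 \<in> range (\<lambda>g. g +o P\<^sub>0)" by blast
  then show ?thesis
    using assms unfolding punctured_hull_def translation_hull_def
    by (simp add: in_closure_of topspace_chabauty_fell) (metis left_translate_0)
qed

lemma orbit_meets_open_in_punctured_hull_topology:
  fixes P\<^sub>0 :: "'g::{topological_group_add, t2_space} set"
  assumes P\<^sub>0: "closed P\<^sub>0" "P\<^sub>0 \<noteq> {}"
    and N: "openin (punctured_hull_topology P\<^sub>0) N" "N \<noteq> {}"
  shows "\<exists>g. g +o P\<^sub>0 \<in> N"
proof -
  obtain U where U: "openin chabauty_fell U" "N = U \<inter> punctured_hull P\<^sub>0"
    using N(1) unfolding punctured_hull_topology_def by (auto simp: openin_subtopology)
  obtain P where P: "P \<in> U" "P \<in> punctured_hull P\<^sub>0" using U N(2) by blast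
  then have "P \<in> chabauty_fell closure_of (range (\<lambda>g. g +o P\<^sub>0))"
    unfolding punctured_hull_def translation_hull_def by blast
  then obtain g where "g +o P\<^sub>0 \<in> U"
    using U(1) P(1) unfolding in_closure_of by blast
  moreover have "g +o P\<^sub>0 \<in> punctured_hull P\<^sub>0"
    by (intro left_translate_mem_punctured_hull mem_punctured_hull_self P\<^sub>0)
  ultimately show ?thesis using U(2) by blast
qed

lemma continuous_map_borel_measurable:
  assumes "continuous_map X Y f"
  shows "f \<in> borel_of X \<rightarrow>\<^sub>M borel_of Y"
proof (rule measurable_sigma_sets)
  show "sets (borel_of Y) = sigma_sets (topspace Y) {U. openin Y U}"
    unfolding borel_of_def by (rule sets_measure_of) (auto dest: openin_subset)
  show "{U. openin Y U} \<subseteq> Pow (topspace Y)" by (auto dest: openin_subset)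
  have sp: "space (borel_of X) = topspace X"
    unfolding borel_of_def by (rule space_measure_of) (auto dest: openin_subset)
  show "f \<in> space (borel_of X) \<rightarrow> topspace Y"
    using assms unfolding sp continuous_map_def by auto
  fix U assume "U \<in> {U. openin Y U}"
  then have "openin X (f -` U \<inter> topspace X)"
    using assms openin_continuous_map_preimage[of X Y f U] by (simp add: vimage_def Collect_conj_eq Int_commute)
  moreover have "sets (borel_of X) = sigma_sets (topspace X) {U. openin X U}"
    unfolding borel_of_def by (rule sets_measure_of) (auto dest: openin_subset)
  ultimately show "f -` U \<inter> space (borel_of X) \<in> sets (borel_of X)"
    unfolding sp by (auto intro: sigma_sets.Basic)
qed

section \<open>Cutting a coset with a window\<close>

definition cut_points :: "'h set \<Rightarrow> ('g \<times> 'h) set \<Rightarrow> 'g set" where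
  "cut_points A y = fst ` (y \<inter> UNIV \<times> A)"

lemma mem_cut_points: "x \<in> cut_points A y \<longleftrightarrow> (\<exists>w\<in>A. (x, w) \<in> y)"
  unfolding cut_points_def by force

lemma cut_points_Int_eq_empty_iff: "cut_points A y \<inter> K = {} \<longleftrightarrow> y \<inter> K \<times> A = {}"
  unfolding disjoint_iff mem_cut_points by auto

lemma cut_points_mono: "A \<subseteq> B \<Longrightarrow> cut_points A y \<subseteq> cut_points B y"
  unfolding subset_iff mem_cut_points by blast

lemma cut_points_left_translate:
  "cut_points A ((g, 0) +o y) = g +o cut_points A y" for g :: "'g::group_add" and y :: "('g \<times> 'h::group_add) set"
  by (auto simp: mem_cut_points mem_left_translate)

lemma closed_cut_points:
  fixes y :: "('g::topological_space \<times> 'h::topological_space) set"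
  assumes "closed y" "compact A"
  shows "closed (cut_points A y)"
proof -
  have "closedin euclidean {x \<in> topspace euclidean. \<exists>w\<in>A. (x, w) \<in> y}"
    by (intro closedin_projection_along_compact[of _ euclidean])
      (use assms in \<open>simp_all add: euclidean_product_topology\<close>)
  moreover have "{x \<in> topspace euclidean. \<exists>w\<in>A. (x, w) \<in> y} = cut_points A y"
    by (auto simp: mem_cut_points)
  ultimately show ?thesis by simp
qed

lemma model_set_eq_cut_points:
  fixes \<Gamma> :: "('g::lcsc_group_add \<times> 'h::lcsc_group_add) set"
  assumes "inj_on fst \<Gamma>"
  shows "model_set \<Gamma> ((- h) +o A) = cut_points A ((0, h) +o \<Gamma>)"
proof -
  have star: "star_map \<Gamma> x = s" if "(x, s) \<in> \<Gamma>" for x s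
    using the_inv_into_f_f[OF assms that] by (simp add: star_map_def)
  show ?thesis
  proof (intro set_eqI iffI)
    fix x assume "x \<in> model_set \<Gamma> ((- h) +o A)"
    then obtain s where s: "(x, s) \<in> \<Gamma>" "s \<in> (- h) +o A"
      unfolding model_set_def using star by auto
    then have "h + s \<in> A" "(x, h + s) \<in> (0, h) +o \<Gamma>"
      by (simp_all add: mem_left_translate)
    then show "x \<in> cut_points A ((0, h) +o \<Gamma>)" by (auto simp: mem_cut_points)
  next
    fix x assume "x \<in> cut_points A ((0, h) +o \<Gamma>)"
    then obtain w where w: "w \<in> A" "(x, - h + w) \<in> \<Gamma>"
      by (auto simp: mem_cut_points mem_left_translate)
    then show "x \<in> model_set \<Gamma> ((- h) +o A)"
      unfolding model_set_def using star[OF w(2)] by (force simp: mem_left_translate)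
  qed
qed

text \<open>
  The topological part of the data of a regular model set. A discrete subgroup enters through its
  closedness, which makes cosets closed subsets of \<open>G \<times> H\<close>.
\<close>

locale window_over_subgroup =
  fixes \<Gamma> :: "('g::lcsc_group_add \<times> 'h::lcsc_group_add) set" and W :: "'h set"
  assumes subgroup: "add_subgroup \<Gamma>"
    and closed_subgroup: "closed \<Gamma>"
    and inj_fst: "inj_on fst \<Gamma>"
    and dense_snd: "closure (snd ` \<Gamma>) = UNIV"
    and compact_window: "compact W"
    and interior_window_nonempty: "interior W \<noteq> {}"
    and closure_interior_window: "closure (interior W) = W"
    and stabilizer_window: "\<And>h. h +o W = W \<Longrightarrow> h = 0"
begin

text \<open>
  When cosets converge, points over the interior of the window persist in the limit of the cut sets
  and no points outside the window appear, but points over its boundary may or may not be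
  limits. Hence two bounds, and no equation, describe the limits of translates of a model set.
\<close>

definition fits :: "('g \<times> 'h) set \<Rightarrow> 'g set \<Rightarrow> bool" where
  "fits y P \<longleftrightarrow> cut_points (interior W) y \<subseteq> P \<and> P \<subseteq> cut_points W y"

lemma fits_left_translate: "fits y P \<Longrightarrow> fits ((g, 0) +o y) (g +o P)"
  unfolding fits_def cut_points_left_translate by (auto simp: elt_set_plus_def)

lemma fits_cut_points: "fits y (cut_points W y)"
  unfolding fits_def by (simp add: cut_points_mono interior_subset)

lemma subgroup_mem_coset_space: "\<Gamma> \<in> coset_space \<Gamma>"
  unfolding coset_space_def using left_translate_0[of \<Gamma>] by (metis rangeI)

lemma dense_snd_meets_open:
  assumes "open U" "U \<noteq> {}"
  obtains r s where "(r, s) \<in> \<Gamma>" "s \<in> U"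
proof -
  have "snd ` \<Gamma> \<inter> U \<noteq> {}"
    using assms dense_snd by (metis Int_UNIV_left Int_commute open_Int_closure_eq_empty)
  then show ?thesis using that by auto
qed

lemma cut_points_interior_window_nonempty:
  assumes "y \<in> coset_space \<Gamma>"
  shows "cut_points (interior W) y \<noteq> {}"
proof -
  obtain g h where y: "y = (g, h) +o \<Gamma>"
    using assms unfolding coset_space_def by auto
  have "open ((\<lambda>s. h + s) -` interior W)"
    by (intro open_vimage continuous_intros) simp
  moreover obtain w where "w \<in> interior W" using interior_window_nonempty by blast
  then have "- h + w \<in> (\<lambda>s. h + s) -` interior W" by (simp add: add.assoc[symmetric])
  ultimately obtain r s where rs: "(r, s) \<in> \<Gamma>" "s \<in> (\<lambda>s. h + s) -` interior W"
    using dense_snd_meets_open by blast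
  then have "(g + r, h + s) \<in> y" unfolding y by (simp add: mem_left_translate add.assoc[symmetric])
  then have "g + r \<in> cut_points (interior W) y" unfolding mem_cut_points using rs(2) by auto
  then show ?thesis by blast
qed

text \<open>
  The hypothesis says that \<open>w + s \<in> interior W\<close> implies \<open>v + s \<in> W\<close> for every \<open>s\<close> in the projection of
  \<open>\<Gamma>\<close> to \<open>H\<close>; injectivity of the other projection ensures that the point \<open>x + r\<close> determines \<open>s\<close>. As the
  condition on the left is open and the one on the right is closed, density extends the implication to
  all \<open>s\<close>. It extends from the interior to \<open>W\<close> because \<open>W\<close> is the closure of its interior.
\<close>

lemma window_translate_subset:
  assumes "cut_points (interior W) ((x, w) +o \<Gamma>) \<subseteq> cut_points W ((x, v) +o \<Gamma>)"
  shows "(v - w) +o W \<subseteq> W"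
proof -
  have closed_W: "closed W" using compact_window compact_imp_closed by blast
  have on_group: "v + s \<in> W" if "(r, s) \<in> \<Gamma>" "w + s \<in> interior W" for r s
  proof -
    have "x + r \<in> cut_points (interior W) ((x, w) +o \<Gamma>)"
      using that by (auto simp: mem_cut_points mem_left_translate add.assoc[symmetric] intro!: bexI[of _ "w + s"])
    then have "x + r \<in> cut_points W ((x, v) +o \<Gamma>)" using assms by blast
    then obtain u where u: "u \<in> W" "(r, - v + u) \<in> \<Gamma>"
      by (auto simp: mem_cut_points mem_left_translate add.assoc[symmetric])
    then have "- v + u = s" using inj_fst that(1) unfolding inj_on_def by fastforce
    then have "v + s = u" by auto
    then show ?thesis using u(1) by simp
  qed
  have "open ((\<lambda>s. w + s) -` interior W)"
    by (intro open_vimage continuous_intros) simp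
  then have "(\<lambda>s. w + s) -` interior W \<subseteq> closure ((\<lambda>s. w + s) -` interior W \<inter> snd ` \<Gamma>)"
    using open_Int_closure_subset[of "(\<lambda>s. w + s) -` interior W" "snd ` \<Gamma>"] dense_snd by simp
  also have "\<dots> \<subseteq> (\<lambda>s. v + s) -` W"
    by (intro closure_minimal closed_vimage continuous_intros closed_W) (use on_group in auto)
  finally have 1: "(\<lambda>s. w + s) -` interior W \<subseteq> (\<lambda>s. v + s) -` W" .
  have "interior W \<subseteq> (\<lambda>u. v + (- w + u)) -` W"
  proof
    fix u assume "u \<in> interior W"
    then have "- w + u \<in> (\<lambda>s. w + s) -` interior W" by (simp add: add.assoc[symmetric])
    then have "- w + u \<in> (\<lambda>s. v + s) -` W" using 1 by blast
    then show "u \<in> (\<lambda>u. v + (- w + u)) -` W" by simp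
  qed
  then have "closure (interior W) \<subseteq> (\<lambda>u. v + (- w + u)) -` W"
    by (intro closure_minimal closed_vimage continuous_intros closed_W)
  then show ?thesis
    unfolding closure_interior_window by (auto simp: elt_set_plus_def add.assoc[symmetric] subset_iff)
qed

text \<open>
  A set that is fitted by a coset is nonempty, and any of its points is a point \<open>x\<close> over which both
  cosets can be based. Comparing the lower bound of one coset with the upper bound of the
  other, in both directions, yields an element of the stabilizer of the window.
\<close>

lemma fitting_coset_unique:
  assumes "y \<in> coset_space \<Gamma>" "fits y P" "z \<in> coset_space \<Gamma>" "fits z P"
  shows "y = z"
proof -
  obtain x where "x \<in> P"
    using assms cut_points_interior_window_nonempty unfolding fits_def by blast
  then obtain w v where "(x, w) \<in> y" "(x, v) \<in> z"
    using assms unfolding fits_def mem_cut_points subset_iff by meson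
  then have y: "y = (x, w) +o \<Gamma>" and z: "z = (x, v) +o \<Gamma>"
    using assms coset_eq_if_mem_coset_space[OF subgroup] by blast+
  have "(v - w) +o W \<subseteq> W" "(w - v) +o W \<subseteq> W"
    using assms unfolding fits_def y z by (auto intro!: window_translate_subset)
  moreover have "(v - w) + (w - v) = 0" by (metis minus_diff_eq right_minus)
  then have "W = (v - w) +o ((w - v) +o W)"
    by (simp only: left_translate_left_translate left_translate_0)
  moreover have "(v - w) +o ((w - v) +o W) \<subseteq> (v - w) +o W"
    using \<open>(w - v) +o W \<subseteq> W\<close> by (auto simp: elt_set_plus_def)
  ultimately have "(v - w) +o W = W" by blast
  then have "v - w = 0" by (rule stabilizer_window)
  then show ?thesis using y z by simp
qed

text \<open>
  If \<open>x \<in> P\<close> is not a cut point of \<open>y\<close>, then \<open>y\<close> misses \<open>K \<times> W\<close> for some compact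
  neighbourhood \<open>K\<close> of \<open>x\<close>. So do all nearby cosets, and these fit no set that meets \<open>K\<close>. If
  \<open>(x, w) \<in> y\<close> with \<open>w \<in> interior W\<close> but \<open>x \<notin> P\<close>, the roles are exchanged: all nearby cosets meet
  \<open>U \<times> interior W\<close> for a neighbourhood \<open>U\<close> of \<open>x\<close>, and all nearby closed sets miss a
  compact set containing \<open>U\<close>.
\<close>

lemma closedin_fits:
  "closedin (prod_topology chabauty_fell (coset_topology \<Gamma>))
     {(P, y). closed P \<and> y \<in> coset_space \<Gamma> \<and> fits y P}" (is "closedin ?Z ?R")
proof -
  have "openin ?Z (topspace ?Z - ?R)"
    unfolding openin_prod_topology_alt
  proof (intro allI impI)
    fix P y assume "(P, y) \<in> topspace ?Z - ?R"
    then have P: "closed P" and y: "y \<in> coset_space \<Gamma>" and "\<not> fits y P"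
      by (auto simp: topspace_chabauty_fell)
    then consider x where "x \<in> cut_points (interior W) y" "x \<notin> P"
      | x where "x \<in> P" "x \<notin> cut_points W y" unfolding fits_def by blast
    then show "\<exists>U V. openin chabauty_fell U \<and> openin (coset_topology \<Gamma>) V \<and> P \<in> U \<and> y \<in> V \<and>
        U \<times> V \<subseteq> topspace ?Z - ?R"
    proof cases
      case 1
      then obtain w where w: "w \<in> interior W" "(x, w) \<in> y" by (auto simp: mem_cut_points)
      obtain U K where U: "open U" "compact K" "x \<in> U" "U \<subseteq> K" "K \<subseteq> - P"
        using compact_neighbourhood_inside_open[of "- P" x] 1 P by (auto simp: open_Compl)
      let ?U = "{C. closed C \<and> C \<inter> K = {}}"
      let ?V = "{z \<in> coset_space \<Gamma>. z \<inter> U \<times> interior W \<noteq> {}}"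
      have "openin chabauty_fell ?U" by (rule openin_chabauty_fell_missing_compact[OF U(2)])
      moreover have "openin (coset_topology \<Gamma>) ?V"
        by (intro openin_cosets_meeting_open open_Times U open_interior)
      moreover have "P \<in> ?U" "y \<in> ?V" using P U y w by auto
      moreover have "\<not> fits z C" if "C \<in> ?U" "z \<in> ?V" for z C
        using that U(4) unfolding fits_def subset_iff mem_cut_points by blast
      then have "?U \<times> ?V \<subseteq> topspace ?Z - ?R" by (auto simp: topspace_chabauty_fell)
      ultimately show ?thesis by blast
    next
      case 2
      have "closed (cut_points W y)"
        by (intro closed_cut_points closed_coset[OF closed_subgroup y] compact_window)
      then obtain U K where U: "open U" "compact K" "x \<in> U" "U \<subseteq> K" "K \<subseteq> - cut_points W y"
        using compact_neighbourhood_inside_open[of "- cut_points W y" x] 2 by (auto simp: open_Compl)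
      let ?U = "{C. closed C \<and> C \<inter> U \<noteq> {}}"
      let ?V = "{z \<in> coset_space \<Gamma>. z \<inter> K \<times> W = {}}"
      have "openin chabauty_fell ?U" by (rule openin_chabauty_fell_meeting_open[OF U(1)])
      moreover have "openin (coset_topology \<Gamma>) ?V"
        by (intro openin_cosets_missing_compact closed_subgroup compact_Times U compact_window)
      moreover have "P \<in> ?U" "y \<in> ?V"
        using P U y 2 by (auto simp: mem_cut_points)
      moreover have "\<not> fits z C" if "C \<in> ?U" "z \<in> ?V" for z C
        using that U(4) unfolding fits_def subset_iff mem_cut_points by blast
      then have "?U \<times> ?V \<subseteq> topspace ?Z - ?R" by (auto simp: topspace_chabauty_fell)
      ultimately show ?thesis by blast
    qed
  qed
  moreover have "?R \<subseteq> topspace ?Z" by (auto simp: topspace_chabauty_fell)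
  ultimately show ?thesis unfolding closedin_def by blast
qed

text \<open>
  If \<open>P\<close> meets \<open>K\<close>, every coset fitting \<open>P\<close> is of this form, because \<open>P\<close> lies in the upper bound. So a
  compact \<open>K\<close> confines the cosets that fit the sets meeting it to a compact set.
\<close>

abbreviation cosets_over :: "'g set \<Rightarrow> ('g \<times> 'h) set set" where
  "cosets_over K \<equiv> (\<lambda>z. z +o \<Gamma>) ` (K \<times> W)"

lemma compactin_cosets_over: "compact K \<Longrightarrow> compactin (coset_topology \<Gamma>) (cosets_over K)"
  using image_compactin[OF _ quotient_imp_continuous_map[OF quotient_map_coset_topology], of "K \<times> W" \<Gamma>]
    compact_window by (simp add: compact_Times)

lemma fitting_coset_mem_cosets_over:
  assumes "y \<in> coset_space \<Gamma>" "fits y P" "P \<inter> K \<noteq> {}"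
  shows "y \<in> cosets_over K"
proof -
  obtain x where x: "x \<in> P" "x \<in> K" using assms(3) by blast
  then obtain w where "w \<in> W" "(x, w) \<in> y"
    using assms(2) unfolding fits_def mem_cut_points subset_iff by meson
  then have "y = (x, w) +o \<Gamma>" "(x, w) \<in> K \<times> W"
    using coset_eq_if_mem_coset_space[OF subgroup assms(1)] x by auto
  then show ?thesis by blast
qed

section \<open>The parametrization map\<close>

abbreviation model_hull :: "'g set set" where
  "model_hull \<equiv> punctured_hull (cut_points W \<Gamma>)"

abbreviation model_hull_topology :: "'g set topology" where
  "model_hull_topology \<equiv> punctured_hull_topology (cut_points W \<Gamma>)"

lemma closed_model_set: "closed (cut_points W \<Gamma>)"
  by (intro closed_cut_points closed_subgroup compact_window)

lemma model_set_nonempty: "cut_points W \<Gamma> \<noteq> {}"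
  using cut_points_interior_window_nonempty[OF subgroup_mem_coset_space]
    cut_points_mono[OF interior_subset, of W \<Gamma>] by blast

lemma model_set_mem_hull: "cut_points W \<Gamma> \<in> model_hull"
  by (intro mem_punctured_hull_self closed_model_set model_set_nonempty)

lemma openin_hull_meeting_open:
  "open U \<Longrightarrow> openin model_hull_topology {P \<in> model_hull. P \<inter> U \<noteq> {}}"
  using openin_chabauty_fell_meeting_open[of U] closed_if_mem_punctured_hull
  unfolding punctured_hull_topology_def openin_subtopology
  by (intro exI[of _ "{C. closed C \<and> C \<inter> U \<noteq> {}}"]) blast

lemma closedin_fits_hull:
  "closedin (prod_topology model_hull_topology (coset_topology \<Gamma>))
     {(P, y). P \<in> model_hull \<and> y \<in> coset_space \<Gamma> \<and> fits y P}"
proof -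
  have "prod_topology model_hull_topology (coset_topology \<Gamma>)
      = subtopology (prod_topology chabauty_fell (coset_topology \<Gamma>)) (model_hull \<times> coset_space \<Gamma>)"
    unfolding punctured_hull_topology_def
    using subtopology_Times[of chabauty_fell "coset_topology \<Gamma>" model_hull "coset_space \<Gamma>"]
    by (metis subtopology_topspace topspace_coset_topology)
  then show ?thesis
    using closedin_fits closed_if_mem_punctured_hull[of _ "cut_points W \<Gamma>"]
    by (auto simp: closedin_subtopology intro!: exI[of _ "{(P, y). closed P \<and> y \<in> coset_space \<Gamma> \<and> fits y P}"])
qed

text \<open>
  The elements of the hull fitted by an element of the compact set \<open>cosets_over K\<close> form a closed
  set \<open>B\<close>. Every translate of the model set by some \<open>g\<close> that meets \<open>K\<close> belongs to \<open>B\<close>, being fitted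
  by the coset of \<open>(g, 0)\<close>. A set \<open>P\<close> in the hull with an element in the interior of \<open>K\<close> is a limit of
  such translates, so it belongs to \<open>B\<close> too.
\<close>

lemma fitting_coset_exists:
  assumes P: "P \<in> model_hull"
  shows "\<exists>y\<in>coset_space \<Gamma>. fits y P"
proof (rule ccontr)
  assume none: "\<not> ?thesis"
  obtain x where "x \<in> P" using P unfolding punctured_hull_def by blast
  obtain U K where U: "open U" "compact K" "x \<in> U" "U \<subseteq> K"
    using ex_compact_neighbourhood by blast
  define B where "B = {P \<in> topspace model_hull_topology.
    \<exists>y\<in>cosets_over K. (P, y) \<in> {(P, y). P \<in> model_hull \<and> y \<in> coset_space \<Gamma> \<and> fits y P}}"
  have "closedin model_hull_topology B"
    unfolding B_def
    by (rule closedin_projection_along_compact[OF closedin_fits_hull compactin_cosets_over[OF U(2)]])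
  then have "openin model_hull_topology ({P \<in> model_hull. P \<inter> U \<noteq> {}} - B)"
    by (intro openin_diff openin_hull_meeting_open U)
  moreover have "P \<in> {P \<in> model_hull. P \<inter> U \<noteq> {}} - B"
    using P \<open>x \<in> P\<close> U(3) none unfolding B_def by auto
  ultimately obtain g where g: "g +o cut_points W \<Gamma> \<in> {P \<in> model_hull. P \<inter> U \<noteq> {}} - B"
    using orbit_meets_open_in_punctured_hull_topology[OF closed_model_set model_set_nonempty] by blast
  let ?y = "(g, 0) +o \<Gamma>"
  have y: "?y \<in> coset_space \<Gamma>" unfolding coset_space_def by blast
  have fit: "fits ?y (g +o cut_points W \<Gamma>)"
    by (intro fits_left_translate fits_cut_points)
  have "?y \<in> cosets_over K"
    by (rule fitting_coset_mem_cosets_over[OF y fit]) (use g U(4) in blast)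
  then show False
    using g y fit unfolding B_def topspace_punctured_hull_topology by blast
qed

definition fitting_coset :: "'g set \<Rightarrow> ('g \<times> 'h) set" where
  "fitting_coset = (\<lambda>P\<in>model_hull. THE y. y \<in> coset_space \<Gamma> \<and> fits y P)"

lemma fitting_coset:
  assumes "P \<in> model_hull"
  shows "fitting_coset P \<in> coset_space \<Gamma>" "fits (fitting_coset P) P"
proof -
  have "\<exists>!y. y \<in> coset_space \<Gamma> \<and> fits y P"
    using fitting_coset_exists[OF assms] fitting_coset_unique by blast
  then have "fitting_coset P \<in> coset_space \<Gamma> \<and> fits (fitting_coset P) P"
    unfolding fitting_coset_def restrict_apply'[OF assms] by (rule theI')
  then show "fitting_coset P \<in> coset_space \<Gamma>" "fits (fitting_coset P) P" by blast+
qed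

lemma fitting_coset_eqI:
  assumes "P \<in> model_hull" "y \<in> coset_space \<Gamma>" "fits y P"
  shows "fitting_coset P = y"
  using fitting_coset[OF assms(1)] fitting_coset_unique assms by blast

lemma fitting_coset_left_translate:
  assumes "P \<in> model_hull"
  shows "fitting_coset (g +o P) = (g, 0) +o fitting_coset P"
  by (intro fitting_coset_eqI left_translate_mem_punctured_hull left_translate_mem_coset_space
      fits_left_translate fitting_coset assms)

lemma closedin_graph_fitting_coset:
  "closedin (prod_topology model_hull_topology (coset_topology \<Gamma>)) {(P, fitting_coset P) | P. P \<in> model_hull}"
proof -
  have "{(P, fitting_coset P) | P. P \<in> model_hull} = {(P, y). P \<in> model_hull \<and> y \<in> coset_space \<Gamma> \<and> fits y P}"
    using fitting_coset fitting_coset_eqI by auto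
  then show ?thesis using closedin_fits_hull by simp
qed

lemma continuous_map_fitting_coset:
  "continuous_map model_hull_topology (coset_topology \<Gamma>) fitting_coset"
proof (rule continuous_map_if_closed_graph_locally_compact_range)
  show "fitting_coset \<in> topspace model_hull_topology \<rightarrow> topspace (coset_topology \<Gamma>)"
    using fitting_coset by (auto simp: topspace_punctured_hull_topology)
  show "closedin (prod_topology model_hull_topology (coset_topology \<Gamma>))
      {(P, fitting_coset P) | P. P \<in> topspace model_hull_topology}"
    using closedin_graph_fitting_coset by (simp add: topspace_punctured_hull_topology)
next
  fix P assume "P \<in> topspace model_hull_topology"
  then have P: "P \<in> model_hull" by (simp add: topspace_punctured_hull_topology)
  then obtain x where "x \<in> P" unfolding punctured_hull_def by blast
  obtain U K where U: "open U" "compact K" "x \<in> U" "U \<subseteq> K"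
    using ex_compact_neighbourhood by blast
  have "fitting_coset ` {P \<in> model_hull. P \<inter> U \<noteq> {}} \<subseteq> cosets_over K"
  proof (rule image_subsetI)
    fix C assume "C \<in> {P \<in> model_hull. P \<inter> U \<noteq> {}}"
    then show "fitting_coset C \<in> cosets_over K"
      by (intro fitting_coset_mem_cosets_over[of _ C] fitting_coset) (use U(4) in auto)
  qed
  moreover have "P \<in> {P \<in> model_hull. P \<inter> U \<noteq> {}}" using P \<open>x \<in> P\<close> U(3) by blast
  ultimately show "\<exists>N Q. openin model_hull_topology N \<and> P \<in> N \<and> compactin (coset_topology \<Gamma>) Q \<and>
      fitting_coset ` N \<subseteq> Q"
    using openin_hull_meeting_open[OF U(1)] compactin_cosets_over[OF U(2)] by blast
qed

lemma parametrization_map_fitting_coset: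
  "parametrization_map \<Gamma> (cut_points W \<Gamma>) fitting_coset"
  unfolding parametrization_map_def
proof (intro conjI allI ballI)
  show "fitting_coset \<in> model_hull \<rightarrow>\<^sub>E coset_space \<Gamma>"
    using fitting_coset by (auto simp: fitting_coset_def)
  show "fitting_coset \<in> borel_of model_hull_topology \<rightarrow>\<^sub>M borel_of (coset_topology \<Gamma>)"
    by (rule continuous_map_borel_measurable[OF continuous_map_fitting_coset])
  show "fitting_coset (cut_points W \<Gamma>) = (0, 0) +o \<Gamma>"
    using fitting_coset_eqI[OF model_set_mem_hull subgroup_mem_coset_space fits_cut_points]
    by (simp add: left_translate_0 flip: zero_prod_def)
qed (simp_all add: fitting_coset_left_translate closedin_graph_fitting_coset)

text \<open>
  The continuous map \<open>P \<mapsto> (P, fitting_coset P)\<close> pulls the closed graph of \<open>\<beta>\<close> back to a closed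
  subset of the punctured hull. This subset contains the orbit of the model set, which is dense.
\<close>

lemma parametrization_map_unique:
  assumes \<beta>: "parametrization_map \<Gamma> (cut_points W \<Gamma>) \<beta>"
  shows "\<beta> = fitting_coset"
proof -
  let ?G = "{(P, \<beta> P) | P. P \<in> model_hull}"
  define C where "C = {P \<in> topspace model_hull_topology. (P, fitting_coset P) \<in> ?G}"
  have \<beta>_fun: "\<beta> \<in> model_hull \<rightarrow>\<^sub>E coset_space \<Gamma>"
    and \<beta>_equi: "\<And>g P. P \<in> model_hull \<Longrightarrow> \<beta> (g +o P) = (g, 0) +o \<beta> P"
    and \<beta>_base: "\<beta> (cut_points W \<Gamma>) = (0, 0) +o \<Gamma>"
    and \<beta>_graph: "closedin (prod_topology model_hull_topology (coset_topology \<Gamma>)) ?G"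
    using \<beta> unfolding parametrization_map_def by blast+
  have "continuous_map model_hull_topology (prod_topology model_hull_topology (coset_topology \<Gamma>))
      (\<lambda>P. (P, fitting_coset P))"
    by (simp add: continuous_map_pairedI continuous_map_fitting_coset)
  then have "closedin model_hull_topology C"
    unfolding C_def by (rule closedin_continuous_map_preimage[OF _ \<beta>_graph])
  then have "openin model_hull_topology (model_hull - C)"
    by (simp add: closedin_def topspace_punctured_hull_topology)
  moreover have "g +o cut_points W \<Gamma> \<notin> model_hull - C" for g
  proof -
    have fc: "fitting_coset (cut_points W \<Gamma>) = \<beta> (cut_points W \<Gamma>)"
      using parametrization_map_fitting_coset \<beta>_base unfolding parametrization_map_def by simp
    have "fitting_coset (g +o cut_points W \<Gamma>) = \<beta> (g +o cut_points W \<Gamma>)"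
      using \<beta>_equi fitting_coset_left_translate model_set_mem_hull fc by simp
    then show ?thesis unfolding C_def topspace_punctured_hull_topology by auto
  qed
  ultimately have "model_hull \<subseteq> C"
    using orbit_meets_open_in_punctured_hull_topology[OF closed_model_set model_set_nonempty] by blast
  then have "\<beta> P = fitting_coset P" if "P \<in> model_hull" for P
    using that unfolding C_def by blast
  moreover have "\<beta> P = fitting_coset P" if "P \<notin> model_hull" for P
    using that by (simp add: PiE_arb[OF \<beta>_fun] fitting_coset_def)
  ultimately show ?thesis by (intro ext) blast
qed

text \<open>
  All first coordinates of a coset of \<open>(0, h)\<close> lie in the projection of \<open>\<Gamma>\<close> to \<open>G\<close>. Conversely, if
  \<open>x \<in> P\<close> is the first coordinate of \<open>(x, s) \<in> \<Gamma>\<close> and \<open>(x, w)\<close> lies in the coset of \<open>P\<close>, then so does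
  \<open>(x, w) - (x, s) = (0, w - s)\<close>.
\<close>

lemma mem_canonical_transversal_iff:
  assumes P: "P \<in> model_hull"
  shows "P \<in> canonical_transversal \<Gamma> (cut_points W \<Gamma>) \<longleftrightarrow> (\<exists>h. fitting_coset P = (0, h) +o \<Gamma>)"
proof
  assume "P \<in> canonical_transversal \<Gamma> (cut_points W \<Gamma>)"
  moreover obtain x where "x \<in> P" using P unfolding punctured_hull_def by blast
  ultimately obtain s where s: "x \<in> P" "(x, s) \<in> \<Gamma>" unfolding canonical_transversal_def by auto
  then obtain w where "(x, w) \<in> fitting_coset P"
    using fitting_coset(2)[OF P] unfolding fits_def mem_cut_points subset_iff by meson
  then have "fitting_coset P = (x, w) +o \<Gamma>"
    using coset_eq_if_mem_coset_space[OF subgroup fitting_coset(1)[OF P]] by blast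
  moreover have "(0, w - s) \<in> (x, w) +o \<Gamma>"
  proof -
    have "- (x, s) \<in> \<Gamma>" using subgroup s(2) unfolding add_subgroup_def by blast
    then show ?thesis by (simp add: mem_left_translate diff_conv_add_uminus add.assoc[symmetric] del: add_uminus_conv_diff)
  qed
  ultimately show "\<exists>h. fitting_coset P = (0, h) +o \<Gamma>"
    using coset_eq_if_mem[OF subgroup] by metis
next
  assume "\<exists>h. fitting_coset P = (0, h) +o \<Gamma>"
  then obtain h where h: "fitting_coset P = (0, h) +o \<Gamma>" by blast
  have "cut_points W ((0, h) +o \<Gamma>) \<subseteq> fst ` \<Gamma>"
    by (force simp: mem_cut_points mem_left_translate)
  then show "P \<in> canonical_transversal \<Gamma> (cut_points W \<Gamma>)"
    using P fitting_coset(2)[OF P] unfolding h fits_def canonical_transversal_def by auto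
qed

section \<open>Nonsingular cosets\<close>

text \<open>
  For these cosets the upper and lower bound in the definition of \<open>fits\<close> agree. They include the
  nonsingular ones, and this equality is the form in which nonsingularity of a coset is used.
\<close>

definition generic_cosets :: "('g \<times> 'h) set set" where
  "generic_cosets = {y \<in> coset_space \<Gamma>. cut_points W y \<subseteq> cut_points (interior W) y}"

lemma generic_cosets_left_translate: "y \<in> generic_cosets \<Longrightarrow> (g, 0) +o y \<in> generic_cosets"
  unfolding generic_cosets_def
  by (simp add: left_translate_mem_coset_space cut_points_left_translate set_plus_mono)

text \<open>
  A point of \<open>y\<close> over the boundary of \<open>W\<close> would give an element of \<open>snd ` \<Gamma>\<close> on the boundary of the
  translated window \<open>(- h) +o W\<close>.
\<close>

lemma nonsingular_cosets_subset_generic_cosets: "nonsingular_cosets \<Gamma> W \<subseteq> generic_cosets"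
proof
  fix y assume "y \<in> nonsingular_cosets \<Gamma> W"
  then obtain g h where y: "y = (g, h) +o \<Gamma>"
    and reg: "frontier ((- h) +o W) \<inter> snd ` \<Gamma> = {}"
    unfolding nonsingular_cosets_def gamma_regular_def by blast
  have "x \<in> cut_points (interior W) y" if x: "x \<in> cut_points W y" for x
  proof -
    obtain w where w: "w \<in> W" "(- g + x, - h + w) \<in> \<Gamma>" "(x, w) \<in> y"
      using x unfolding y by (auto simp: mem_cut_points mem_left_translate)
    then have "- h + w \<notin> frontier ((- h) +o W)" using reg by force
    moreover have "- h + w \<in> (- h) +o W" using w(1) by (auto simp: elt_set_plus_def)
    then have "- h + w \<in> closure ((- h) +o W)" using closure_subset by blast
    ultimately have "- h + w \<in> interior ((- h) +o W)" unfolding frontier_def by blast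
    then have "w \<in> (\<lambda>u. - h + u) -` interior ((- h) +o W)" by simp
    moreover have "(\<lambda>u. - h + u) -` interior ((- h) +o W) \<subseteq> W"
      using interior_subset[of "(- h) +o W"] by (auto simp: mem_left_translate add.assoc[symmetric] subset_iff)
    moreover have "open ((\<lambda>u. - h + u) -` interior ((- h) +o W))"
      by (intro open_vimage continuous_intros) simp
    ultimately have "w \<in> interior W" by (meson interiorI)
    then show ?thesis using w(3) by (auto simp: mem_cut_points)
  qed
  then show "y \<in> generic_cosets" unfolding generic_cosets_def y coset_space_def by blast
qed

lemma fits_generic_coset_iff: "y \<in> generic_cosets \<Longrightarrow> fits y P \<longleftrightarrow> P = cut_points W y"
  unfolding generic_cosets_def fits_def using cut_points_mono[OF interior_subset, of W y] by blast

lemma continuous_map_cut_points_generic: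
  "continuous_map (subtopology (coset_topology \<Gamma>) generic_cosets) chabauty_fell (cut_points W)"
    (is "continuous_map ?Y _ _")
proof (rule continuous_map_into_chabauty_fell)
  have top: "topspace ?Y = generic_cosets" unfolding generic_cosets_def by auto
  show "closed (cut_points W y)" if "y \<in> topspace ?Y" for y
    by (intro closed_cut_points closed_coset[OF closed_subgroup] compact_window)
      (use that in auto)
  show "openin ?Y {y \<in> topspace ?Y. cut_points W y \<inter> V \<noteq> {}}" if V: "open V" for V
  proof -
    have "openin (coset_topology \<Gamma>) {y \<in> coset_space \<Gamma>. y \<inter> V \<times> interior W \<noteq> {}}"
      by (intro openin_cosets_meeting_open open_Times V open_interior)
    moreover have "{y \<in> topspace ?Y. cut_points W y \<inter> V \<noteq> {}}
        = {y \<in> coset_space \<Gamma>. y \<inter> V \<times> interior W \<noteq> {}} \<inter> generic_cosets"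
    proof -
      have "cut_points W y \<inter> V \<noteq> {} \<longleftrightarrow> y \<inter> V \<times> interior W \<noteq> {}" if "y \<in> generic_cosets" for y
      proof -
        have "cut_points W y = cut_points (interior W) y"
          using fits_generic_coset_iff[OF that] cut_points_mono[OF interior_subset, of W y] that
          unfolding generic_cosets_def by blast
        then show ?thesis by (simp add: cut_points_Int_eq_empty_iff)
      qed
      then show ?thesis unfolding top by (auto simp: generic_cosets_def)
    qed
    ultimately show ?thesis by (auto simp: openin_subtopology)
  qed
  show "openin ?Y {y \<in> topspace ?Y. cut_points W y \<inter> K = {}}" if K: "compact K" for K
  proof -
    have "openin (coset_topology \<Gamma>) {y \<in> coset_space \<Gamma>. y \<inter> K \<times> W = {}}"
      by (intro openin_cosets_missing_compact closed_subgroup compact_Times K compact_window)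
    moreover have "{y \<in> topspace ?Y. cut_points W y \<inter> K = {}}
        = {y \<in> coset_space \<Gamma>. y \<inter> K \<times> W = {}} \<inter> generic_cosets"
      unfolding top cut_points_Int_eq_empty_iff by (auto simp: generic_cosets_def)
    ultimately show ?thesis by (auto simp: openin_subtopology)
  qed
qed

text \<open>
  The union of the cosets of all \<open>(g, 0)\<close> is the product of \<open>G\<close> with the projection of \<open>\<Gamma>\<close> to \<open>H\<close>,
  which is dense.
\<close>

lemma orbit_meets_open_in_coset_topology:
  assumes "openin (coset_topology \<Gamma>) T" "y \<in> T"
  shows "\<exists>g. (g, 0) +o \<Gamma> \<in> T"
proof -
  have T: "T \<subseteq> coset_space \<Gamma>" "open ((\<lambda>z. z +o \<Gamma>) -` T)"
    using assms(1) by (auto simp: openin_coset_topology)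
  then obtain a b where "y = (a, b) +o \<Gamma>" using assms(2) unfolding coset_space_def by auto
  then have "(a, b) \<in> (\<lambda>z. z +o \<Gamma>) -` T" using assms(2) by simp
  then obtain A B where AB: "open A" "open B" "a \<in> A" "b \<in> B" "A \<times> B \<subseteq> (\<lambda>z. z +o \<Gamma>) -` T"
    using T(2) by (elim open_prod_elim) auto
  then obtain r s where rs: "(r, s) \<in> \<Gamma>" "s \<in> B" using dense_snd_meets_open by blast
  have "(a, s) \<in> (a - r, 0) +o \<Gamma>" using rs(1) by (simp add: mem_left_translate)
  then have "(a - r, 0) +o \<Gamma> = (a, s) +o \<Gamma>" by (rule coset_eq_if_mem[OF subgroup])
  also have "\<dots> \<in> T" using AB rs(2) by auto
  finally show ?thesis by blast
qed

text \<open>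
  The orbit of the trivial coset is dense and consists of generic cosets, so continuity of
  \<open>cut_points W\<close> on generic cosets carries the density over to the orbit of the model set.
\<close>

lemma cut_points_generic_mem_hull:
  assumes base: "\<Gamma> \<in> generic_cosets" and y: "y \<in> generic_cosets"
  shows "cut_points W y \<in> model_hull"
proof -
  let ?Y = "subtopology (coset_topology \<Gamma>) generic_cosets"
  let ?O = "range (\<lambda>g. (g, 0) +o \<Gamma>)"
  have O: "?O \<subseteq> generic_cosets" using generic_cosets_left_translate[OF base] by blast
  have "y \<in> ?Y closure_of ?O"
    unfolding in_closure_of
  proof (intro conjI allI impI)
    show "y \<in> topspace ?Y" using y by (auto simp: generic_cosets_def)
    fix T assume "y \<in> T \<and> openin ?Y T"
    then obtain S where S: "openin (coset_topology \<Gamma>) S" "T = S \<inter> generic_cosets" "y \<in> S"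
      by (auto simp: openin_subtopology)
    then obtain g where "(g, 0) +o \<Gamma> \<in> S" using orbit_meets_open_in_coset_topology by blast
    moreover have "(g, 0) +o \<Gamma> \<in> generic_cosets" using O by (rule subsetD) (rule rangeI)
    ultimately have "(g, 0) +o \<Gamma> \<in> T" unfolding S(2) by (rule IntI)
    then show "\<exists>z. z \<in> ?O \<and> z \<in> T" by (intro exI conjI) (rule rangeI)
  qed
  then have "cut_points W y \<in> cut_points W ` (?Y closure_of ?O)" by blast
  also have "\<dots> \<subseteq> chabauty_fell closure_of (cut_points W ` ?O)"
    by (rule continuous_map_image_closure_subset[OF continuous_map_cut_points_generic])
  also have "cut_points W ` ?O = range (\<lambda>g. g +o cut_points W \<Gamma>)"
    by (simp add: image_image cut_points_left_translate)
  finally have "cut_points W y \<in> translation_hull (cut_points W \<Gamma>)"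
    unfolding translation_hull_def .
  moreover have "cut_points W y \<noteq> {}"
    using y cut_points_interior_window_nonempty[of y] cut_points_mono[OF interior_subset, of W y]
    unfolding generic_cosets_def by blast
  ultimately show ?thesis unfolding punctured_hull_def by blast
qed

lemma bij_betw_fitting_coset:
  assumes "\<Gamma> \<in> generic_cosets" "Z \<subseteq> generic_cosets"
  shows "bij_betw fitting_coset {P \<in> model_hull. fitting_coset P \<in> Z} Z"
proof (rule bij_betw_byWitness[where f' = "cut_points W"])
  show "\<forall>P\<in>{P \<in> model_hull. fitting_coset P \<in> Z}. cut_points W (fitting_coset P) = P"
    using fitting_coset(2) fits_generic_coset_iff assms(2) by blast
  have "fitting_coset (cut_points W y) = y" "cut_points W y \<in> model_hull" if "y \<in> Z" for y
    using that assms cut_points_generic_mem_hull fitting_coset_eqI fits_cut_points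
    by (auto simp: generic_cosets_def subset_iff)
  then show "\<forall>y\<in>Z. fitting_coset (cut_points W y) = y"
    "cut_points W ` Z \<subseteq> {P \<in> model_hull. fitting_coset P \<in> Z}" by auto
qed auto

end

section \<open>The parametrization theorem\<close>

theorem theorem3p1:
  fixes \<Gamma> :: "('g::lcsc_group_add \<times> 'h::lcsc_group_add) set"
    and m\<^sub>H :: "'h measure" and W\<^sub>0 :: "'h set" and P\<^sub>0 :: "'g set"
  assumes "cut_and_project_scheme \<Gamma>"
    and "haar_measure m\<^sub>H"
    and "regular_window \<Gamma> m\<^sub>H W\<^sub>0"
    and "P\<^sub>0 = model_set \<Gamma> W\<^sub>0"
  shows "(\<exists>!\<beta>. parametrization_map \<Gamma> P\<^sub>0 \<beta>) \<and>
    (\<forall>\<beta>. parametrization_map \<Gamma> P\<^sub>0 \<beta> \<longrightarrow>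
      (let Yns = nonsingular_cosets \<Gamma> W\<^sub>0; Xns = {P \<in> punctured_hull P\<^sub>0. \<beta> P \<in> Yns} in
        bij_betw \<beta> Xns Yns \<and>
        (\<forall>P\<in>punctured_hull P\<^sub>0.
           P \<in> canonical_transversal \<Gamma> P\<^sub>0 \<longleftrightarrow> (\<exists>h. \<beta> P = (0, h) +o \<Gamma>)) \<and>
        (\<forall>P \<in> canonical_transversal \<Gamma> P\<^sub>0 \<inter> Xns. \<forall>h. \<beta> P = (0, h) +o \<Gamma> \<longrightarrow>
           P = model_set \<Gamma> ((- h) +o W\<^sub>0)) \<and>
        (compact_space (coset_topology \<Gamma>) \<longrightarrow>
           continuous_map (punctured_hull_topology P\<^sub>0) (coset_topology \<Gamma>) \<beta>)))"
proof -
  have \<Gamma>: "add_subgroup \<Gamma>" "discrete \<Gamma>" "inj_on fst \<Gamma>" "closure (snd ` \<Gamma>) = UNIV"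
    using assms(1) unfolding cut_and_project_scheme_def is_lattice_def by blast+
  have W: "compact W\<^sub>0" "interior W\<^sub>0 \<noteq> {}" "W\<^sub>0 = closure (interior W\<^sub>0)"
    "{h. h +o W\<^sub>0 = W\<^sub>0} = {0}" "gamma_regular \<Gamma> W\<^sub>0"
    using assms(3) unfolding regular_window_def by - (elim conjE, assumption)+
  interpret window_over_subgroup \<Gamma> W\<^sub>0
    by unfold_locales
      (use \<Gamma> W(1,2,4) W(3)[symmetric] closed_discrete_subgroup[OF \<Gamma>(1,2)] in \<open>blast+\<close>)
  have model_eq: "model_set \<Gamma> ((- h) +o W\<^sub>0) = cut_points W\<^sub>0 ((0, h) +o \<Gamma>)" for h
    by (rule model_set_eq_cut_points[OF \<Gamma>(3)])
  have \<Gamma>_eq: "\<Gamma> = (0, 0) +o \<Gamma>" using left_translate_0[of \<Gamma>] by (simp add: zero_prod_def)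
  have P\<^sub>0: "P\<^sub>0 = cut_points W\<^sub>0 \<Gamma>"
    using model_eq[of 0] \<Gamma>_eq assms(4) left_translate_0[of W\<^sub>0] by simp
  have "\<Gamma> \<in> nonsingular_cosets \<Gamma> W\<^sub>0"
    unfolding nonsingular_cosets_def
    using \<Gamma>_eq W(5) left_translate_0[of W\<^sub>0] by (intro CollectI exI[of _ 0]) simp
  then have bij: "bij_betw fitting_coset {P \<in> model_hull. fitting_coset P \<in> nonsingular_cosets \<Gamma> W\<^sub>0}
      (nonsingular_cosets \<Gamma> W\<^sub>0)"
    by (intro bij_betw_fitting_coset) (use nonsingular_cosets_subset_generic_cosets in blast)+
  have model: "P = model_set \<Gamma> ((- h) +o W\<^sub>0)"
    if "P \<in> model_hull" "fitting_coset P \<in> nonsingular_cosets \<Gamma> W\<^sub>0" "fitting_coset P = (0, h) +o \<Gamma>" for P h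
    using that fitting_coset(2)[OF that(1)] fits_generic_coset_iff[of "fitting_coset P" P]
      nonsingular_cosets_subset_generic_cosets model_eq[of h] by auto
  show ?thesis
  proof (intro conjI allI impI)
    show "\<exists>!\<beta>. parametrization_map \<Gamma> P\<^sub>0 \<beta>"
      unfolding P\<^sub>0 using parametrization_map_fitting_coset parametrization_map_unique by blast
  next
    fix \<beta> assume "parametrization_map \<Gamma> P\<^sub>0 \<beta>"
    then have \<beta>: "\<beta> = fitting_coset" unfolding P\<^sub>0 by (rule parametrization_map_unique)
    show "let Yns = nonsingular_cosets \<Gamma> W\<^sub>0; Xns = {P \<in> punctured_hull P\<^sub>0. \<beta> P \<in> Yns} in
        bij_betw \<beta> Xns Yns \<and>
        (\<forall>P\<in>punctured_hull P\<^sub>0.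
           P \<in> canonical_transversal \<Gamma> P\<^sub>0 \<longleftrightarrow> (\<exists>h. \<beta> P = (0, h) +o \<Gamma>)) \<and>
        (\<forall>P \<in> canonical_transversal \<Gamma> P\<^sub>0 \<inter> Xns. \<forall>h. \<beta> P = (0, h) +o \<Gamma> \<longrightarrow>
           P = model_set \<Gamma> ((- h) +o W\<^sub>0)) \<and>
        (compact_space (coset_topology \<Gamma>) \<longrightarrow>
           continuous_map (punctured_hull_topology P\<^sub>0) (coset_topology \<Gamma>) \<beta>)"
      unfolding \<beta> P\<^sub>0 Let_def
      by (intro conjI ballI allI impI bij mem_canonical_transversal_iff continuous_map_fitting_coset)
        (use model in blast)+
  qed
qed

end
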